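(* For every finite state space $E=\{1,\ldots,N\}$ there exists a standard universal dilation $\big(G,\phi,(Q_{\{P\}})_{\{P\}\in\mathcal{P}}\big)$ of the Markov evolutions in $\mathcal{L}^\infty(\mathcal{E})$ (as defined in the context). That is: there exist a finite set $G$ and an invertible map $\phi:E\times G\to E\times G$, both depending only on $E$, and for every sequence of stochastic matrices $\{P\}\in\mathcal{P}$ a probability measure $Q_{\{P\}}$ on $(G^{\mathbb{Z}},\mathcal{G})$, such that for every $\{P\}\in\mathcal{P}$ the triple $(G,\phi,Q_{\{P\}})$ is a standard dilation of the Markov evolution $\{P\}$.
   Context: $\mathbb{N}=\{1,2,\ldots\}$. $E=\{1,\ldots,N\}$ is a finite set with power $\sigma$-algebra $\mathcal{E}$, and $\mathcal{L}^\infty(\mathcal{E})$ is the $*$-algebra of functions $f:E\to\mathbb{C}$. A stochastic matrix on $E$ is $P=(P_{ij})_{i,j\in E}$ with $P_{ij}\ge 0$ and $\sum_j P_{ij}=1$ for every $i$; it acts by $(Pf)(i)=\sum_j P_{ij}f(j)$. $\mathcal{P}$ is the set of all sequences $\{P\}=(P(t))_{t\ge0}$ of stochastic matrices on $E$ with $P(0)$ the identity matrix. The Markov evolution $\{P\}$ is $f\mapsto P(1)\cdots P(t)f$, $t\ge 0$. Markov chain with transition matrices $\{P\}$: a term $(\Omega,\mathcal{F},(\mathcal{F}_t)_{t\ge0},(X_t)_{t\ge0},(\mathbb{P}_k)_{k\in E})$, where $(\mathcal{F}_t)$ is a filtration on the measurable space $(\Omega,\mathcal{F})$, the $X_t:\Omega\to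 E$ are random variables adapted to $(\mathcal{F}_t)$, and the $\mathbb{P}_k$ are probability measures on $\mathcal F$ such that $X_0$ has distribution $\delta_k$ under $\mathbb{P}_k$ and $$\mathbb{P}_k(X_{t+1}=j\mid\mathcal{F}_t)=\mathbb{P}_k(X_{t+1}=j\mid X_t)=P(t+1)_{X_t j}\qquad\text{for all } k,j\in E,\ t\ge 0 .$$ Dilation of the Markov evolution $\{P\}$: a term $(\Omega,\mathcal{F},(\mathcal{F}_t)_{t\ge0},(Z_t)_{t\ge0},(\mathbb{P}_k)_{k\in E})$ such that - every $Z_t=(X_t,\Upsilon_t)$ is a random variable on $(\Omega,\mathcal{F})$ with values in $(E\times\Gamma,\mathcal{E}\otimes\mathcal{G})$, for a fixed measurable space $(\Gamma,\mathcal{G})$; - $(\Omega,\mathcal{F},(\mathcal{F}_t)_{t\ge0},(X_t)_{t\ge0},(\mathbb{P}_k)_{k\in E})$ is a Markov chain with transition matrices $\{P\}$; - $(X_0,\Upsilon_0)$ has distribution $\delta_k\otimes Q$ under $\mathbb{P}_k$, for a fixed distribution $Q$ on $\mathcal{G}$; - there exists an invertible bimeasurable map $\alpha:E\times\Gamma\to E\times\Gamma$ such that $Z_t=\alpha^t(Z_0)$ for every $t\ge0$. Standard dilation of $\{P\}$: a dilation of $\{P\}$ of the following form. - $\Gamma=G^{\mathbb{Z}}=\prod_{n\in\mathbb{Z}}G_n$ with $G_n=G$ a finite set (with its power $\sigma$-algebra), and $\mathcal{G}$ the cylinder $\sigma$-algebra. - $\Omega=E\times\Gamma$, with points $\omega=(i,\gamma)=(i,(g_n)_{n\in\mathbb{Z}})$.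 - $X_0(\omega)=i$, $Y_n(\omega)=g_n$, $\Upsilon_0(\omega)=\gamma$, $Z_0(\omega)=\omega$. - $\mathcal{F}=\mathcal{E}\otimes\mathcal{G}$ and $\mathcal{F}_t=\sigma(X_0,Y_s;\,1\le s\le t)$, $t\ge0$ (so $\mathcal{F}_0=\sigma(X_0)$). - $\mathbb{P}_k=\delta_k\otimes Q$ with $Q=Q_0\otimes\big(\bigotimes_{n\in\mathbb{N}}q(n)\big)$, where $Q_0$ is a probability on $\sigma(Y_n;\,n\le0)$ (the law of $(Y_n)_{n\le 0}$) and $q(n)$ is a probability on $G$ (the law of $Y_n$), $n\ge1$. - $\alpha=\vartheta\circ\phi_1$, where $\phi:E\times G\to E\times G$ is an invertible map, $\phi_1$ is $\phi$ acting on the coordinates $E\times G_1$ and extended to $\Omega$ by the identity on the other coordinates, and $\vartheta$ is the left shift $(g_n)_{n\in\mathbb{Z}}\mapsto(g_{n+1})_{n\in\mathbb{Z}}$ on $\Gamma$, extended to $\Omega$ by the identity on $E$. - Hence $Z_t=\alpha^t\circ Z_0=(X_t,\Upsilon_t)$, with $X_t=X_0\circ\alpha^t$ and $\Upsilon_t=\Upsilon_0\circ\alpha^t$. Such a standard dilation is specified by, and denoted by, the triple $(G,\phi,Q)$. Universal dilation of the Markov evolutions in $\mathcal{L}^\infty(\mathcal{E})$: a term $(\Omega,\mathcal{F},(\mathcal{F}_t)_{t\ge0},(Z_t)_{t\ge0},(\mathbb{P}_{k,\{P\}})_{k\in E,\{P\}\in\mathcal{P}})$ such that for every $\{P\}\in\mathcal{P}$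 the term $(\Omega,\mathcal{F},(\mathcal{F}_t)_{t\ge0},(Z_t)_{t\ge0},(\mathbb{P}_{k,\{P\}})_{k\in E})$ is a dilation of the Markov evolution $\{P\}$. It is called standard if it is given by a family of standard dilations $(G,\phi,Q_{\{P\}})$, $\{P\}\in\mathcal{P}$, all with the same $G$ and the same $\phi$; it is then denoted $\big(G,\phi,(Q_{\{P\}})_{\{P\}\in\mathcal{P}}\big)$. *)

theory Defs
  imports "HOL-Probability.Probability"
begin

section \<open>Markov evolutions\<close>

text \<open>
  Matrices indexed by a finite set \<open>E\<close> are functions of two arguments; only the entries with
  both indices in \<open>E\<close> are meaningful, and none of the notions below reads any other entry.
\<close>

definition stochastic_matrix :: "'e set \<Rightarrow> ('e \<Rightarrow> 'e \<Rightarrow> real) \<Rightarrow> bool" where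
  "stochastic_matrix E A \<longleftrightarrow>
     (\<forall>i\<in>E. \<forall>j\<in>E. 0 \<le> A i j) \<and> (\<forall>i\<in>E. (\<Sum>j\<in>E. A i j) = 1)"

definition stochastic_sequences :: "'e set \<Rightarrow> (nat \<Rightarrow> 'e \<Rightarrow> 'e \<Rightarrow> real) set" where
  "stochastic_sequences E =
     {P. (\<forall>t. stochastic_matrix E (P t)) \<and>
         (\<forall>i\<in>E. \<forall>j\<in>E. P 0 i j = (if i = j then 1 else 0))}"


section \<open>Markov chains and dilations\<close>

text \<open>
  A measurable space is represented by a measure whose values are ignored: only \<^term>\<open>space M\<close>
  and \<^term>\<open>sets M\<close> of the arguments \<open>M\<close>, \<open>F t\<close> and \<open>\<Gamma>\<close> below matter.
\<close>

definition cond_prob_on :: "'w measure \<Rightarrow> 'w measure \<Rightarrow> 'w set \<Rightarrow> 'w \<Rightarrow> real" where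
  "cond_prob_on Pr H A = real_cond_exp Pr H (indicat_real A)"

definition markov_chain ::
  "'e set \<Rightarrow> (nat \<Rightarrow> 'e \<Rightarrow> 'e \<Rightarrow> real) \<Rightarrow> 'w measure \<Rightarrow> (nat \<Rightarrow> 'w measure) \<Rightarrow>
   (nat \<Rightarrow> 'w \<Rightarrow> 'e) \<Rightarrow> ('e \<Rightarrow> 'w measure) \<Rightarrow> bool" where
  "markov_chain E P M F X Pr \<longleftrightarrow>
     filtration (space M) F \<and> (\<forall>t. subalgebra M (F t)) \<and>
     (\<forall>t. X t \<in> F t \<rightarrow>\<^sub>M count_space E) \<and>
     (\<forall>k\<in>E. prob_space (Pr k) \<and> sets (Pr k) = sets M \<and>
        distr (Pr k) (count_space E) (X 0) = return (count_space E) k) \<and>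
     (\<forall>k\<in>E. \<forall>j\<in>E. \<forall>t.
        let A = {\<omega> \<in> space M. X (Suc t) \<omega> = j};
            \<sigma>X = vimage_algebra (space M) (X t) (count_space E)
        in (AE \<omega> in Pr k. cond_prob_on (Pr k) (F t) A \<omega> = cond_prob_on (Pr k) \<sigma>X A \<omega>) \<and>
           (AE \<omega> in Pr k. cond_prob_on (Pr k) \<sigma>X A \<omega> = P (Suc t) (X t \<omega>) j))"

definition invertible_bimeasurable :: "'a measure \<Rightarrow> ('a \<Rightarrow> 'a) \<Rightarrow> bool" where
  "invertible_bimeasurable M \<alpha> \<longleftrightarrow>
     bij_betw \<alpha> (space M) (space M) \<and> \<alpha> \<in> M \<rightarrow>\<^sub>M M \<and> inv_into (space M) \<alpha> \<in> M \<rightarrow>\<^sub>M M"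

definition dilation ::
  "'e set \<Rightarrow> (nat \<Rightarrow> 'e \<Rightarrow> 'e \<Rightarrow> real) \<Rightarrow> 'c measure \<Rightarrow> 'w measure \<Rightarrow> (nat \<Rightarrow> 'w measure) \<Rightarrow>
   (nat \<Rightarrow> 'w \<Rightarrow> 'e \<times> 'c) \<Rightarrow> ('e \<Rightarrow> 'w measure) \<Rightarrow> bool" where
  "dilation E P \<Gamma> M F Z Pr \<longleftrightarrow>
     (\<forall>t. Z t \<in> M \<rightarrow>\<^sub>M count_space E \<Otimes>\<^sub>M \<Gamma>) \<and>
     markov_chain E P M F (\<lambda>t \<omega>. fst (Z t \<omega>)) Pr \<and>
     (\<exists>Q. prob_space Q \<and> sets Q = sets \<Gamma> \<and>
        (\<forall>k\<in>E. distr (Pr k) (count_space E \<Otimes>\<^sub>M \<Gamma>) (Z 0) = return (count_space E) k \<Otimes>\<^sub>M Q)) \<and>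
     (\<exists>\<alpha>. invertible_bimeasurable (count_space E \<Otimes>\<^sub>M \<Gamma>) \<alpha> \<and>
        (\<forall>t. \<forall>\<omega>\<in>space M. Z t \<omega> = (\<alpha> ^^ t) (Z 0 \<omega>)))"

definition universal_dilation ::
  "'e set \<Rightarrow> 'c measure \<Rightarrow> 'w measure \<Rightarrow> (nat \<Rightarrow> 'w measure) \<Rightarrow> (nat \<Rightarrow> 'w \<Rightarrow> 'e \<times> 'c) \<Rightarrow>
   ((nat \<Rightarrow> 'e \<Rightarrow> 'e \<Rightarrow> real) \<Rightarrow> 'e \<Rightarrow> 'w measure) \<Rightarrow> bool" where
  "universal_dilation E \<Gamma> M F Z Pr \<longleftrightarrow>
     (\<forall>P\<in>stochastic_sequences E. dilation E P \<Gamma> M F Z (Pr P))"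


section \<open>Standard dilations\<close>

definition noise_space :: "'g set \<Rightarrow> (int \<Rightarrow> 'g) measure" where
  "noise_space G = (\<Pi>\<^sub>M n\<in>UNIV. count_space G)"

definition std_space :: "'e set \<Rightarrow> 'g set \<Rightarrow> ('e \<times> (int \<Rightarrow> 'g)) measure" where
  "std_space E G = count_space E \<Otimes>\<^sub>M noise_space G"

definition std_filtration ::
  "'e set \<Rightarrow> 'g set \<Rightarrow> nat \<Rightarrow> ('e \<times> (int \<Rightarrow> 'g)) measure" where
  "std_filtration E G t =
     sigma (space (std_space E G))
       ({fst -` A \<inter> space (std_space E G) | A. A \<subseteq> E} \<union>
        {(\<lambda>\<omega>. snd \<omega> s) -` B \<inter> space (std_space E G) | s B. 1 \<le> s \<and> s \<le> int t \<and> B \<subseteq> G})"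

definition left_shift :: "'e \<times> (int \<Rightarrow> 'g) \<Rightarrow> 'e \<times> (int \<Rightarrow> 'g)" where
  "left_shift = (\<lambda>(i, g). (i, \<lambda>n. g (n + 1)))"

definition act_on_first ::
  "('e \<times> 'g \<Rightarrow> 'e \<times> 'g) \<Rightarrow> 'e \<times> (int \<Rightarrow> 'g) \<Rightarrow> 'e \<times> (int \<Rightarrow> 'g)" where
  "act_on_first \<phi> = (\<lambda>(i, g). let (j, h) = \<phi> (i, g 1) in (j, g(1 := h)))"

definition std_process ::
  "('e \<times> 'g \<Rightarrow> 'e \<times> 'g) \<Rightarrow> nat \<Rightarrow> 'e \<times> (int \<Rightarrow> 'g) \<Rightarrow> 'e \<times> (int \<Rightarrow> 'g)" where
  "std_process \<phi> t = (left_shift \<circ> act_on_first \<phi>) ^^ t"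

text \<open>
  The law \<open>Q0\<close> of the coordinates \<open>n \<le> 0\<close> is arbitrary, the coordinates \<open>n \<ge> 1\<close> are independent
  with laws \<open>q n\<close>; \<^term>\<open>merge {..0} {1..}\<close> identifies the product of the two partial sequence
  spaces with the space of two-sided sequences.
\<close>

definition std_noise_law :: "'g set \<Rightarrow> (int \<Rightarrow> 'g) measure \<Rightarrow> bool" where
  "std_noise_law G Q \<longleftrightarrow>
     (\<exists>Q0 q. prob_space Q0 \<and> sets Q0 = sets (\<Pi>\<^sub>M n\<in>{..0::int}. count_space G) \<and>
        (\<forall>n\<ge>1. prob_space (q n) \<and> sets (q n) = sets (count_space G)) \<and>
        Q = distr (Q0 \<Otimes>\<^sub>M (\<Pi>\<^sub>M n\<in>{1::int..}. q n)) (noise_space G) (merge {..0} {1..}))"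

definition std_prob :: "'e set \<Rightarrow> (int \<Rightarrow> 'g) measure \<Rightarrow> 'e \<Rightarrow> ('e \<times> (int \<Rightarrow> 'g)) measure" where
  "std_prob E Q k = return (count_space E) k \<Otimes>\<^sub>M Q"

definition standard_dilation ::
  "'e set \<Rightarrow> (nat \<Rightarrow> 'e \<Rightarrow> 'e \<Rightarrow> real) \<Rightarrow> 'g set \<Rightarrow> ('e \<times> 'g \<Rightarrow> 'e \<times> 'g) \<Rightarrow>
   (int \<Rightarrow> 'g) measure \<Rightarrow> bool" where
  "standard_dilation E P G \<phi> Q \<longleftrightarrow>
     finite G \<and> bij_betw \<phi> (E \<times> G) (E \<times> G) \<and> std_noise_law G Q \<and>
     dilation E P (noise_space G) (std_space E G) (std_filtration E G) (std_process \<phi>)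
       (std_prob E Q)"

definition standard_universal_dilation ::
  "'e set \<Rightarrow> 'g set \<Rightarrow> ('e \<times> 'g \<Rightarrow> 'e \<times> 'g) \<Rightarrow>
   ((nat \<Rightarrow> 'e \<Rightarrow> 'e \<Rightarrow> real) \<Rightarrow> (int \<Rightarrow> 'g) measure) \<Rightarrow> bool" where
  "standard_universal_dilation E G \<phi> Q \<longleftrightarrow>
     universal_dilation E (noise_space G) (std_space E G) (std_filtration E G) (std_process \<phi>)
       (\<lambda>P. std_prob E (Q P)) \<and>
     (\<forall>P\<in>stochastic_sequences E. standard_dilation E P G \<phi> (Q P))"

end

theory Submission
  imports Defs
begin

text \<open>
  Take for \<open>G\<close> the set of all maps \<open>f\<close> from \<open>E\<close> to \<open>E\<close>, and let \<open>f\<close> act as the update \<open>i \<mapsto> f i\<close>.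
  If \<open>f\<close> is drawn with probability \<open>\<Prod>k\<in>E. P n k (f k)\<close>, its values are independent and \<open>f i\<close> has
  law \<open>P n i\<close>, so every stochastic matrix is realised by the same update rule and only the law of
  the noise depends on it. The update extends to a bijection of \<open>E \<times> G\<close>: fix \<open>a \<in> E\<close>, precompose
  \<open>f\<close> with the transposition of \<open>a\<close> and \<open>i\<close>, so that \<open>f i\<close> sits in the \<open>a\<close>-coordinate, and then
  exchange \<open>i\<close> with that coordinate; both maps are involutions.

  Since \<open>\<alpha>\<close> alters the noise only at coordinate 1 before shifting it to coordinate 0, the process
  satisfies \<open>X (t + 1) = fst (\<phi> (X t, Y (t + 1)))\<close>, where \<open>Y (t + 1)\<close> is independent of the past.
\<close>

section \<open>Conditional probabilities of an update driven by independent noise\<close>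

text \<open>On the event that \<open>X\<close> equals \<open>i\<close>, the update depends on
  \<open>Y\<close> alone, so independence from \<open>F\<close> contributes the factor
  \<open>p i\<close>. Summing over the finitely many values of \<open>X\<close> gives the integral
  identity characterising the conditional expectation. Since \<open>F\<close> may be any
  sub-sigma-algebra making \<open>X\<close> measurable, the result serves both the whole past and
  the present state alone.\<close>

lemma (in prob_space) cond_exp_independent_noise:
  assumes sub: "subalgebra M F" and "finite E"
    and X: "X \<in> F \<rightarrow>\<^sub>M count_space E" and Y: "Y \<in> M \<rightarrow>\<^sub>M count_space G"
    and indep: "\<And>C D. C \<in> sets F \<Longrightarrow> D \<subseteq> G \<Longrightarrow>
      prob (C \<inter> (Y -` D \<inter> space M)) = prob C * prob (Y -` D \<inter> space M)"
    and p: "\<And>i. i \<in> E \<Longrightarrow> prob {\<omega> \<in> space M. f i (Y \<omega>) = j} = p i"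
  shows "AE \<omega> in M. real_cond_exp M F (indicat_real {\<omega> \<in> space M. f (X \<omega>) (Y \<omega>) = j}) \<omega>
    = p (X \<omega>)"
proof -
  interpret finite_measure_subalgebra M F
    by unfold_locales (fact sub)
  let ?A = "{\<omega> \<in> space M. f (X \<omega>) (Y \<omega>) = j}"
  let ?X = "\<lambda>i. X -` {i} \<inter> space M"
  let ?Y = "\<lambda>i. {\<omega> \<in> space M. f i (Y \<omega>) = j}"
  have spF: "space F = space M" and setsF: "sets F \<subseteq> sets M"
    using sub by (auto simp: subalgebra_def)
  have XE: "X \<omega> \<in> E" if "\<omega> \<in> space M" for \<omega>
    using measurable_space[OF X] that by (simp add: spF)
  have YG: "Y \<omega> \<in> G" if "\<omega> \<in> space M" for \<omega>
    using measurable_space[OF Y] that by simp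
  have XF: "?X i \<in> sets F" if "i \<in> E" for i
    using measurable_sets[OF X, of "{i}"] that by (simp add: spF)
  have Y_eq: "?Y i = Y -` {y \<in> G. f i y = j} \<inter> space M" for i
    using YG by auto
  have YM: "?Y i \<in> sets M" for i
    unfolding Y_eq by (rule measurable_sets[OF Y]) auto
  have A_eq: "?A = (\<Union>i\<in>E. ?X i \<inter> ?Y i)"
    using XE by auto
  have AM: "?A \<in> sets M"
    unfolding A_eq using XF setsF YM \<open>finite E\<close> by (intro sets.finite_UN) auto
  have pF: "(\<lambda>\<omega>. p (X \<omega>)) \<in> borel_measurable F"
    by (rule measurable_compose[OF X]) simp
  \<comment> \<open>\<open>p (X \<omega>)\<close> is a simple function, which makes it integrable
    and lets its integral over \<open>C\<close> be computed term by term.\<close>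
  have pX: "p (X \<omega>) = (\<Sum>i\<in>E. p i * indicat_real (?X i) \<omega>)" if "\<omega> \<in> space M" for \<omega>
  proof -
    have "(\<Sum>i\<in>E. p i * indicat_real (?X i) \<omega>) = (\<Sum>i\<in>E. if i = X \<omega> then p i else 0)"
      using that by (intro sum.cong) (auto simp: indicator_def)
    also have "\<dots> = p (X \<omega>)"
      using \<open>finite E\<close> XE[OF that] by simp
    finally show ?thesis ..
  qed
  have int_X: "integrable M (indicat_real (C \<inter> ?X i))" if "C \<in> sets F" "i \<in> E" for C i
    using that XF setsF by (intro integrable_real_indicator) (auto simp: emeasure_eq_measure)
  show ?thesis
  proof (rule real_cond_exp_charact)
    fix C assume C: "C \<in> sets F"
    then have CM: "C \<in> sets M"
      using setsF by auto
    have "(\<integral>\<omega>\<in>C. indicat_real ?A \<omega> \<partial>M) = (\<integral>\<omega>. indicat_real (C \<inter> ?A) \<omega> \<partial>M)"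
      unfolding set_lebesgue_integral_def by (simp add: indicator_inter_arith)
    also have "\<dots> = prob (C \<inter> ?A)"
      using CM AM by simp
    also have "C \<inter> ?A = (\<Union>i\<in>E. (C \<inter> ?X i) \<inter> ?Y i)"
      using A_eq by auto
    also have "prob \<dots> = (\<Sum>i\<in>E. prob ((C \<inter> ?X i) \<inter> ?Y i))"
      using CM XF setsF YM \<open>finite E\<close>
      by (intro finite_measure_finite_Union) (auto simp: disjoint_family_on_def)
    also have "\<dots> = (\<Sum>i\<in>E. p i * prob (C \<inter> ?X i))"
    proof (rule sum.cong[OF refl])
      fix i assume i: "i \<in> E"
      have "prob ((C \<inter> ?X i) \<inter> ?Y i) = prob (C \<inter> ?X i) * prob (?Y i)"
        unfolding Y_eq by (rule indep) (use C XF[OF i] in auto)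
      then show "prob ((C \<inter> ?X i) \<inter> ?Y i) = p i * prob (C \<inter> ?X i)"
        using p[OF i] by simp
    qed
    also have "\<dots> = (\<integral>\<omega>. (\<Sum>i\<in>E. p i * indicat_real (C \<inter> ?X i) \<omega>) \<partial>M)"
    proof -
      have "C \<inter> ?X i \<in> sets M" if "i \<in> E" for i
        using that CM XF setsF by auto
      then show ?thesis
        using int_X[OF C] by (subst Bochner_Integration.integral_sum) (auto intro!: sum.cong)
    qed
    also have "\<dots> = (\<integral>\<omega>\<in>C. p (X \<omega>) \<partial>M)"
      unfolding set_lebesgue_integral_def
      by (rule Bochner_Integration.integral_cong)
        (auto simp: pX sum_distrib_left indicator_def intro!: sum.cong)
    finally show "(\<integral>\<omega>\<in>C. indicat_real ?A \<omega> \<partial>M) = (\<integral>\<omega>\<in>C. p (X \<omega>) \<partial>M)" .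
  next
    show "integrable M (indicat_real ?A)"
      using AM by (intro integrable_real_indicator) (auto simp: emeasure_eq_measure)
    have "integrable M (\<lambda>\<omega>. \<Sum>i\<in>E. p i * indicat_real (space M \<inter> ?X i) \<omega>)"
      using int_X[OF sets.top] spF by (intro Bochner_Integration.integrable_sum) auto
    then show "integrable M (\<lambda>\<omega>. p (X \<omega>))"
      by (rule Bochner_Integration.integrable_cong[THEN iffD1, rotated 2])
        (auto simp: pX indicator_def intro!: sum.cong)
  qed (fact pF)
qed

section \<open>The noise law and its cylinder probabilities\<close>

text \<open>No transition matrix occurs in this data: the geometry of the dilation is developed for
  arbitrary one-step laws, and matrices are attached to them only at the end.\<close>

locale standard_data =
  fixes E :: "'e set" and G :: "'g set" and \<phi> :: "'e \<times> 'g \<Rightarrow> 'e \<times> 'g"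
    and Q0 :: "(int \<Rightarrow> 'g) measure" and q :: "int \<Rightarrow> 'g measure"
  assumes finite_E: "finite E" and finite_G: "finite G"
    and bij: "bij_betw \<phi> (E \<times> G) (E \<times> G)"
    and prob_Q0: "prob_space Q0"
    and sets_Q0: "sets Q0 = sets (\<Pi>\<^sub>M n\<in>{..0}. count_space G)"
    and prob_q: "\<And>n. 1 \<le> n \<Longrightarrow> prob_space (q n)"
    and sets_q: "\<And>n. 1 \<le> n \<Longrightarrow> sets (q n) = sets (count_space G)"
begin

definition Q :: "(int \<Rightarrow> 'g) measure" where
  "Q = distr (Q0 \<Otimes>\<^sub>M (\<Pi>\<^sub>M n\<in>{1..}. q n)) (noise_space G) (merge {..0} {1..})"

lemma sets_Q [simp, measurable_cong]: "sets Q = sets (noise_space G)"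
  and space_Q [simp]: "space Q = space (noise_space G)"
  by (simp_all add: Q_def)

lemma space_noise: "space (noise_space G) = {g. \<forall>n. g n \<in> G}"
  by (auto simp: noise_space_def space_PiM)

lemma space_std: "space (std_space E G) = {\<omega>. fst \<omega> \<in> E \<and> (\<forall>n. snd \<omega> n \<in> G)}"
  by (auto simp: std_space_def space_pair_measure space_noise)

lemma merge_noise [measurable]:
  "merge {..0} {1..} \<in> Q0 \<Otimes>\<^sub>M (\<Pi>\<^sub>M n\<in>{1..}. q n) \<rightarrow>\<^sub>M noise_space G"
proof -
  have un: "{..0} \<union> {1..} = (UNIV :: int set)"
    by auto
  have "merge {..0} {1..} \<in> (\<Pi>\<^sub>M n\<in>{..0::int}. count_space G) \<Otimes>\<^sub>M (\<Pi>\<^sub>M n\<in>{1..}. count_space G)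
      \<rightarrow>\<^sub>M noise_space G"
    using measurable_merge[of "{..0::int}" "{1..}" "\<lambda>_. count_space G"]
    unfolding noise_space_def un .
  moreover have "sets (\<Pi>\<^sub>M n\<in>{1..}. q n) = sets (\<Pi>\<^sub>M n\<in>{1..}. count_space G)"
    using sets_q by (intro sets_PiM_cong) auto
  ultimately show ?thesis
    using sets_Q0 by (simp cong: measurable_cong_sets sets_pair_measure_cong)
qed

lemma prob_space_Q: "prob_space Q"
proof -
  interpret Q0: prob_space Q0 by (fact prob_Q0)
  interpret R: prob_space "\<Pi>\<^sub>M n\<in>{1..}. q n"
    using prob_q by (intro prob_space_PiM) auto
  interpret pair_prob_space Q0 "\<Pi>\<^sub>M n\<in>{1..}. q n" ..
  show ?thesis
    unfolding Q_def by (rule prob_space_distr) (fact merge_noise)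
qed

lemma coordinate_measurable [measurable]: "(\<lambda>g. g n) \<in> noise_space G \<rightarrow>\<^sub>M count_space G"
  unfolding noise_space_def by measurable

lemma cylinder_sets:
  assumes "B \<subseteq> G" shows "{g \<in> space (noise_space G). g n \<in> B} \<in> sets (noise_space G)"
  using measurable_sets[OF coordinate_measurable, of B n] assms
  by (simp add: vimage_def Int_def conj_commute)

text \<open>All constrained coordinates lie in \<open>{1..}\<close>, so pulling the cylinder back
  along \<open>merge\<close> leaves the \<open>Q0\<close> factor unconstrained. That factor has mass
  1, and the infinite product measure evaluates the other one.\<close>

lemma emeasure_Q_cylinder:
  assumes J: "finite J" "J \<subseteq> {1..}" and B: "\<And>s. s \<in> J \<Longrightarrow> B s \<subseteq> G"
  shows "emeasure Q {g \<in> space (noise_space G). \<forall>s\<in>J. g s \<in> B s} = (\<Prod>s\<in>J. emeasure (q s) (B s))"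
proof -
  let ?R = "\<Pi>\<^sub>M n\<in>{1..}. q n"
  interpret Q0: prob_space Q0 by (fact prob_Q0)
  interpret R: prob_space ?R
    using prob_q by (intro prob_space_PiM) auto
  have sp_q: "space (q n) = G" if "1 \<le> n" for n
    using sets_eq_imp_space_eq[OF sets_q[OF that]] by simp
  have sp_Q0: "space Q0 = (\<Pi>\<^sub>E n\<in>{..0}. G)"
    using sets_eq_imp_space_eq[OF sets_Q0] by (simp add: space_PiM)
  have sp_R: "space ?R = (\<Pi>\<^sub>E n\<in>{1..}. G)"
    by (auto simp: space_PiM sp_q PiE_def Pi_def)
  have BR: "prod_emb {1..} q J (Pi\<^sub>E J B) \<in> sets ?R"
    using J B sets_q by (intro sets_PiM_I) auto
  have cyl: "{g \<in> space (noise_space G). \<forall>s\<in>J. g s \<in> B s} \<in> sets (noise_space G)"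
    using J B by (intro sets.sets_Collect_finite_All cylinder_sets) auto
  have "emeasure Q {g \<in> space (noise_space G). \<forall>s\<in>J. g s \<in> B s} =
      emeasure (Q0 \<Otimes>\<^sub>M ?R) (merge {..0} {1..} -` {g \<in> space (noise_space G). \<forall>s\<in>J. g s \<in> B s}
        \<inter> space (Q0 \<Otimes>\<^sub>M ?R))"
    unfolding Q_def by (rule emeasure_distr[OF merge_noise cyl])
  also have "merge {..0} {1..} -` {g \<in> space (noise_space G). \<forall>s\<in>J. g s \<in> B s}
        \<inter> space (Q0 \<Otimes>\<^sub>M ?R) = space Q0 \<times> prod_emb {1..} q J (Pi\<^sub>E J B)" (is "?L = ?S")
  proof -
    have merge_G: "merge {..0} {1..} (a, b) \<in> space (noise_space G)"
      if "a \<in> space Q0" "b \<in> space ?R" for a b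
      using measurable_space[OF merge_noise, of "(a, b)"] that by (simp add: space_pair_measure)
    have "merge {..0} {1..} (a, b) s = b s" if "s \<in> J" for a b :: "int \<Rightarrow> 'g" and s
      using that J by (auto simp: merge_def)
    then have "(\<forall>s\<in>J. merge {..0} {1..} (a, b) s \<in> B s) = (\<forall>s\<in>J. b s \<in> B s)" for a b
      by simp
    moreover have "b \<in> prod_emb {1..} q J (Pi\<^sub>E J B) \<longleftrightarrow> b \<in> space ?R \<and> (\<forall>s\<in>J. b s \<in> B s)" for b
      using J by (auto simp: prod_emb_def space_PiM restrict_PiE_iff)
    ultimately show ?thesis
      using merge_G by (auto simp: space_pair_measure)
  qed
  also have "emeasure (Q0 \<Otimes>\<^sub>M ?R) \<dots> = emeasure ?R (prod_emb {1..} q J (Pi\<^sub>E J B))"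
    using BR by (simp add: R.emeasure_pair_measure_Times Q0.emeasure_space_1)
  also have "\<dots> = (\<Prod>s\<in>J. emeasure (q s) (B s))"
    using J B sets_q prob_q by (intro emeasure_PiM_emb) auto
  finally show ?thesis .
qed

section \<open>Measurable maps on the state-noise space\<close>

lemma fst_measurable [measurable]: "fst \<in> std_space E G \<rightarrow>\<^sub>M count_space E"
  unfolding std_space_def by measurable

lemma snd_coordinate_measurable: "(\<lambda>\<omega>. snd \<omega> n) \<in> std_space E G \<rightarrow>\<^sub>M count_space G"
  unfolding std_space_def by measurable

lemma std_space_measurableI:
  assumes "u \<in> M \<rightarrow>\<^sub>M count_space E" and "\<And>n. v n \<in> M \<rightarrow>\<^sub>M count_space G"
  shows "(\<lambda>\<omega>. (u \<omega>, \<lambda>n. v n \<omega>)) \<in> M \<rightarrow>\<^sub>M std_space E G"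
  unfolding std_space_def noise_space_def
  using assms measurable_space[OF assms(2)]
  by (intro measurable_Pair measurable_PiM_single') auto

text \<open>Finiteness of \<open>E\<close> and \<open>G\<close> makes the product of the two
  discrete spaces discrete, so only the range of \<open>f\<close> has to be checked.\<close>

lemma measurable_apply_pair:
  assumes "u \<in> M \<rightarrow>\<^sub>M count_space E" "v \<in> M \<rightarrow>\<^sub>M count_space G"
    and "\<And>x. x \<in> E \<times> G \<Longrightarrow> f x \<in> S"
  shows "(\<lambda>\<omega>. f (u \<omega>, v \<omega>)) \<in> M \<rightarrow>\<^sub>M count_space S"
proof -
  have "(\<lambda>\<omega>. (u \<omega>, v \<omega>)) \<in> M \<rightarrow>\<^sub>M count_space (E \<times> G)"
    using measurable_Pair[OF assms(1,2)] finite_E finite_G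
    by (simp add: pair_measure_countable countable_finite)
  then show ?thesis
    by (rule measurable_compose) (use assms(3) in auto)
qed

section \<open>The one-step map \<alpha> and its inverse\<close>

definition step :: "'e \<times> (int \<Rightarrow> 'g) \<Rightarrow> 'e \<times> (int \<Rightarrow> 'g)" where
  "step = left_shift \<circ> act_on_first \<phi>"

lemma step_eq:
  "step \<omega> = (fst (\<phi> (fst \<omega>, snd \<omega> 1)),
    \<lambda>n. if n = 0 then snd (\<phi> (fst \<omega>, snd \<omega> 1)) else snd \<omega> (n + 1))"
  by (auto simp: step_def left_shift_def act_on_first_def split: prod.splits)

text \<open>The inverse of \<open>step\<close>: the symbol altered by \<phi> now sits at coordinate
  0, from where it is decoded and put back at coordinate 1. The explicit formula allows
  measurability to be checked coordinate by coordinate.\<close>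

definition step_back :: "'e \<times> (int \<Rightarrow> 'g) \<Rightarrow> 'e \<times> (int \<Rightarrow> 'g)" where
  "step_back \<omega> = (fst (inv_into (E \<times> G) \<phi> (fst \<omega>, snd \<omega> 0)),
    \<lambda>n. if n = 1 then snd (inv_into (E \<times> G) \<phi> (fst \<omega>, snd \<omega> 0)) else snd \<omega> (n - 1))"

lemma phi_closed: "x \<in> E \<times> G \<Longrightarrow> \<phi> x \<in> E \<times> G"
  and inv_phi_closed: "x \<in> E \<times> G \<Longrightarrow> inv_into (E \<times> G) \<phi> x \<in> E \<times> G"
  using bij_betwE[OF bij] bij_betwE[OF bij_betw_inv_into[OF bij]] by auto

lemma step_measurable: "step \<in> std_space E G \<rightarrow>\<^sub>M std_space E G"
proof -
  have "(\<lambda>\<omega>. (fst (\<phi> (fst \<omega>, snd \<omega> 1)),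
      \<lambda>n. if n = 0 then snd (\<phi> (fst \<omega>, snd \<omega> 1)) else snd \<omega> (n + 1)))
      \<in> std_space E G \<rightarrow>\<^sub>M std_space E G"
    by (intro std_space_measurableI measurable_If_set measurable_apply_pair[where f="\<lambda>x. fst (\<phi> x)"]
        measurable_apply_pair[where f="\<lambda>x. snd (\<phi> x)"] fst_measurable snd_coordinate_measurable
        measurable_If) (use phi_closed in \<open>auto simp: mem_Times_iff\<close>)
  then show ?thesis
    by (simp add: step_eq[abs_def])
qed

lemma step_back_measurable: "step_back \<in> std_space E G \<rightarrow>\<^sub>M std_space E G"
  unfolding step_back_def[abs_def]
  by (intro std_space_measurableI measurable_apply_pair[where f="\<lambda>x. fst (inv_into (E \<times> G) \<phi> x)"]
        measurable_apply_pair[where f="\<lambda>x. snd (inv_into (E \<times> G) \<phi> x)"] fst_measurable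
        snd_coordinate_measurable measurable_If)
    (use inv_phi_closed in \<open>auto simp: mem_Times_iff\<close>)

lemma step_back_step: "\<omega> \<in> space (std_space E G) \<Longrightarrow> step_back (step \<omega>) = \<omega>"
  using bij_betw_inv_into_left[OF bij, of "(fst \<omega>, snd \<omega> 1)"]
  by (auto simp: step_eq step_back_def space_std prod_eq_iff)

lemma step_step_back: "\<omega> \<in> space (std_space E G) \<Longrightarrow> step (step_back \<omega>) = \<omega>"
  using bij_betw_inv_into_right[OF bij, of "(fst \<omega>, snd \<omega> 0)"]
  by (auto simp: step_eq step_back_def space_std prod_eq_iff)

lemma invertible_step: "invertible_bimeasurable (std_space E G) step"
proof -
  have bij_step: "bij_betw step (space (std_space E G)) (space (std_space E G))"
    using step_back_step step_step_back measurable_space[OF step_measurable]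
      measurable_space[OF step_back_measurable]
    by (intro bij_betw_byWitness[where f'=step_back]) auto
  \<comment> \<open>Bimeasurability is phrased with \<open>inv_into\<close>; agreement with
    \<open>step_back\<close> on the underlying space is enough to transfer measurability.\<close>
  have "inv_into (space (std_space E G)) step \<omega> = step_back \<omega>"
    if "\<omega> \<in> space (std_space E G)" for \<omega>
    using that bij_step step_step_back measurable_space[OF step_back_measurable]
    by (intro inv_into_f_eq) (auto simp: bij_betw_def)
  then have "inv_into (space (std_space E G)) step \<in> std_space E G \<rightarrow>\<^sub>M std_space E G"
    using step_back_measurable by (simp cong: measurable_cong)
  with bij_step step_measurable show ?thesis
    by (simp add: invertible_bimeasurable_def)
qed

section \<open>The process and the noise it consumes\<close>

lemma std_process_Suc: "std_process \<phi> (Suc t) \<omega> = step (std_process \<phi> t \<omega>)"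
  by (simp add: std_process_def step_def)

lemma std_process_0: "std_process \<phi> 0 = (\<lambda>\<omega>. \<omega>)"
  by (auto simp: std_process_def)

lemma std_process_measurable: "std_process \<phi> t \<in> std_space E G \<rightarrow>\<^sub>M std_space E G"
proof (induction t)
  case (Suc t)
  from measurable_compose[OF Suc step_measurable] show ?case
    by (simp only: std_process_Suc[symmetric])
qed (simp add: std_process_0)

text \<open>A step writes only to coordinate 0 of its result, so positive coordinates are merely
  shifted. The induction runs over all \<open>n\<close> because the shift reads coordinate
  \<open>n + 1\<close>.\<close>

lemma snd_std_process: "1 \<le> n \<Longrightarrow> snd (std_process \<phi> t \<omega>) n = snd \<omega> (n + int t)"
proof (induction t arbitrary: n)
  case (Suc t)
  then show ?case
    by (simp add: std_process_Suc step_eq ac_simps)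
qed (simp add: std_process_0)

text \<open>The step from time \<open>t\<close> reads coordinate 1, which by
  \<open>snd_std_process\<close> still holds the original symbol number
  \<open>t + 1\<close>.\<close>

lemma fst_std_process_Suc:
  "fst (std_process \<phi> (Suc t) \<omega>) = fst (\<phi> (fst (std_process \<phi> t \<omega>), snd \<omega> (int (Suc t))))"
  by (simp add: std_process_Suc step_eq snd_std_process)

section \<open>The filtration and adaptedness\<close>

lemma generator_subset:
  "{fst -` A \<inter> space (std_space E G) | A. A \<subseteq> E} \<union>
   {(\<lambda>\<omega>. snd \<omega> s) -` B \<inter> space (std_space E G) | s B. 1 \<le> s \<and> s \<le> int t \<and> B \<subseteq> G}
   \<subseteq> sets (std_space E G)"
  using measurable_sets[OF fst_measurable] measurable_sets[OF snd_coordinate_measurable] by auto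

lemma space_filtration [simp]: "space (std_filtration E G t) = space (std_space E G)"
  unfolding std_filtration_def by (intro space_measure_of) auto

lemma sets_filtration:
  "sets (std_filtration E G t) = sigma_sets (space (std_space E G))
     ({fst -` A \<inter> space (std_space E G) | A. A \<subseteq> E} \<union>
      {(\<lambda>\<omega>. snd \<omega> s) -` B \<inter> space (std_space E G) | s B. 1 \<le> s \<and> s \<le> int t \<and> B \<subseteq> G})"
  unfolding std_filtration_def by (intro sets_measure_of) auto

lemma subalgebra_filtration: "subalgebra (std_space E G) (std_filtration E G t)"
  unfolding subalgebra_def sets_filtration
  using sets.sigma_sets_subset[OF generator_subset] by simp

lemma filtration_filtration: "filtration (space (std_space E G)) (std_filtration E G)"
proof
  fix i j :: nat assume "i \<le> j"
  then have le: "s \<le> int j" if "s \<le> int i" for s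
    using that by simp
  show "sets (std_filtration E G i) \<subseteq> sets (std_filtration E G j)"
    unfolding sets_filtration
  proof (intro sigma_sets_mono' Un_mono order_refl Collect_mono impI)
    fix S assume "\<exists>s B. S = (\<lambda>\<omega>. snd \<omega> s) -` B \<inter> space (std_space E G) \<and>
      1 \<le> s \<and> s \<le> int i \<and> B \<subseteq> G"
    then show "\<exists>s B. S = (\<lambda>\<omega>. snd \<omega> s) -` B \<inter> space (std_space E G) \<and>
      1 \<le> s \<and> s \<le> int j \<and> B \<subseteq> G"
      using le by (elim exE conjE, intro exI conjI) assumption+
  qed
qed simp

lemma fst_adapted: "fst \<in> std_filtration E G t \<rightarrow>\<^sub>M count_space E"
proof (rule measurableI)
  show "fst -` A \<inter> space (std_filtration E G t) \<in> sets (std_filtration E G t)"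
    if "A \<in> sets (count_space E)" for A
    using that unfolding sets_filtration space_filtration by (intro sigma_sets.Basic) auto
qed (auto simp: space_std)

lemma coordinate_adapted:
  assumes "1 \<le> s" "s \<le> int t"
  shows "(\<lambda>\<omega>. snd \<omega> s) \<in> std_filtration E G t \<rightarrow>\<^sub>M count_space G"
proof (rule measurableI)
  show "(\<lambda>\<omega>. snd \<omega> s) -` A \<inter> space (std_filtration E G t) \<in> sets (std_filtration E G t)"
    if "A \<in> sets (count_space G)" for A
    using that assms unfolding sets_filtration space_filtration
    by (intro sigma_sets.Basic UnI2) auto
qed (auto simp: space_std)

text \<open>Each state is a function of the preceding state and one noise symbol with index at most
  \<open>t\<close>. Allowing any \<open>s \<le> t\<close> keeps the sigma-algebra fixed during the
  induction on \<open>s\<close>.\<close>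

lemma std_process_adapted:
  "s \<le> t \<Longrightarrow> (\<lambda>\<omega>. fst (std_process \<phi> s \<omega>)) \<in> std_filtration E G t \<rightarrow>\<^sub>M count_space E"
proof (induction s)
  case 0
  then show ?case
    by (simp add: std_process_0 fst_adapted)
next
  case (Suc s)
  then show ?case
    unfolding fst_std_process_Suc
    by (intro measurable_apply_pair[where f="\<lambda>x. fst (\<phi> x)"] coordinate_adapted)
      (use phi_closed in \<open>auto simp: mem_Times_iff\<close>)
qed

section \<open>Independence and the Markov property from a fixed initial state\<close>

context
  fixes k assumes k: "k \<in> E"
begin

lemma sets_std_prob [simp]: "sets (std_prob E Q k) = sets (std_space E G)"
  and space_std_prob [simp]: "space (std_prob E Q k) = space (std_space E G)"
proof -
  show "sets (std_prob E Q k) = sets (std_space E G)"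
    unfolding std_prob_def std_space_def by (intro sets_pair_measure_cong) auto
  then show "space (std_prob E Q k) = space (std_space E G)"
    by (rule sets_eq_imp_space_eq)
qed

lemma prob_space_std_prob: "prob_space (std_prob E Q k)"
proof -
  interpret Q: prob_space Q by (fact prob_space_Q)
  interpret R: prob_space "return (count_space E) k"
    using k by (intro prob_space_return) auto
  interpret pair_prob_space "return (count_space E) k" Q ..
  show ?thesis
    unfolding std_prob_def by unfold_locales
qed

text \<open>The event is a rectangle: the point mass at \<open>k\<close> yields the indicator and
  \<open>emeasure_Q_cylinder\<close> the product. Each \<open>q s\<close> involved is a probability,
  so all factors are finite and the formula passes to real values.\<close>

lemma measure_std_prob_cylinder:
  assumes A: "A \<subseteq> E" and J: "finite J" "J \<subseteq> {1..}" and B: "\<And>s. s \<in> J \<Longrightarrow> B s \<subseteq> G"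
  shows "measure (std_prob E Q k)
      {\<omega> \<in> space (std_space E G). fst \<omega> \<in> A \<and> (\<forall>s\<in>J. snd \<omega> s \<in> B s)}
    = indicat_real A k * (\<Prod>s\<in>J. measure (q s) (B s))"
proof -
  interpret Q: prob_space Q by (fact prob_space_Q)
  let ?C = "{g \<in> space (noise_space G). \<forall>s\<in>J. g s \<in> B s}"
  have C: "?C \<in> sets Q"
    using J B by (simp, intro sets.sets_Collect_finite_All cylinder_sets) auto
  have "{\<omega> \<in> space (std_space E G). fst \<omega> \<in> A \<and> (\<forall>s\<in>J. snd \<omega> s \<in> B s)} = A \<times> ?C"
    using A by (auto simp: space_std space_noise)
  moreover have "emeasure (std_prob E Q k) (A \<times> ?C)
      = indicator A k * (\<Prod>s\<in>J. emeasure (q s) (B s))"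
    unfolding std_prob_def using A C emeasure_Q_cylinder[OF J B]
    by (simp add: Q.emeasure_pair_measure_Times)
  moreover have "(\<Prod>s\<in>J. emeasure (q s) (B s)) = (\<Prod>s\<in>J. ennreal (measure (q s) (B s)))"
  proof (rule prod.cong[OF refl])
    fix s assume "s \<in> J"
    then interpret prob_space "q s"
      using J by (intro prob_q) auto
    show "emeasure (q s) (B s) = ennreal (measure (q s) (B s))"
      by (rule emeasure_eq_measure)
  qed
  moreover have "\<dots> = ennreal (\<Prod>s\<in>J. measure (q s) (B s))"
    by (rule prod_ennreal) simp
  moreover have "indicator A k * \<dots> = ennreal (indicat_real A k * (\<Prod>s\<in>J. measure (q s) (B s)))"
    by (simp split: split_indicator)
  ultimately show ?thesis
    by (intro measure_eq_emeasure_eq_ennreal) (simp_all add: prod_nonneg)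
qed

text \<open>A pi-system argument: cylinders over the coordinates up to \<open>t\<close> and events
  of coordinate \<open>t + 1\<close> are both stable under intersection. The product formula on them
  extends to the generated sigma-algebras.\<close>

lemma filtration_independent:
  assumes C: "C \<in> sets (std_filtration E G t)" and D: "D \<subseteq> G"
  defines "Y \<equiv> \<lambda>\<omega>. snd \<omega> (int (Suc t))"
  shows "measure (std_prob E Q k) (C \<inter> (Y -` D \<inter> space (std_prob E Q k)))
    = measure (std_prob E Q k) C * measure (std_prob E Q k) (Y -` D \<inter> space (std_prob E Q k))"
proof -
  interpret prob_space "std_prob E Q k" by (fact prob_space_std_prob)
  define cyl where "cyl J A B = {\<omega> \<in> space (std_space E G). fst \<omega> \<in> A \<and> (\<forall>s\<in>J. snd \<omega> s \<in> B s)}"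
    for J A and B :: "int \<Rightarrow> 'g set"
  let ?J = "{1..int t}"
  let ?PS = "{cyl ?J A (B :: int \<Rightarrow> 'g set) | A B. A \<subseteq> E \<and> (\<forall>s. B s \<subseteq> G)}"
  let ?N = "{cyl {int (Suc t)} E (\<lambda>_. D :: 'g set) | D. D \<subseteq> G}"
  have ev: "cyl J A B \<in> events" if "finite J" "A \<subseteq> E" "\<forall>s. B s \<subseteq> G" for J A B
  proof -
    have "{\<omega> \<in> space (std_space E G). fst \<omega> \<in> A} \<in> sets (std_space E G)"
      using measurable_sets[OF fst_measurable, of A] that by (simp add: vimage_def Int_def conj_commute)
    moreover have "{\<omega> \<in> space (std_space E G). snd \<omega> s \<in> B s} \<in> sets (std_space E G)" for s
      using measurable_sets[OF snd_coordinate_measurable, of "B s" s] that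
      by (simp add: vimage_def Int_def conj_commute)
    ultimately show ?thesis
      unfolding cyl_def sets_std_prob using that(1)
      by (intro sets.sets_Collect_conj sets.sets_Collect_finite_All)
  qed
  have "indep_set ?PS ?N"
  proof (rule indep_setI)
    fix a b assume "a \<in> ?PS" "b \<in> ?N"
    then obtain A B D where a: "a = cyl ?J A B" "A \<subseteq> E" "\<And>s. B s \<subseteq> G"
      and b: "b = cyl {int (Suc t)} E (\<lambda>_. D)" "D \<subseteq> G"
      by auto
    \<comment> \<open>The intersection is again one cylinder, with coordinate \<open>t + 1\<close>
      adjoined and constrained by \<open>D\<close>, so its probability splits off the factor of that
      coordinate.\<close>
    let ?J' = "insert (int (Suc t)) ?J"
    have "a \<inter> b = cyl ?J' A (B(int (Suc t) := D))"
      using a b by (auto simp: cyl_def)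
    also have "prob \<dots> = indicat_real A k *
        (\<Prod>s\<in>?J'. measure (q s) ((B(int (Suc t) := D)) s))"
      unfolding cyl_def using a b by (intro measure_std_prob_cylinder) auto
    also have "(\<Prod>s\<in>?J'. measure (q s) ((B(int (Suc t) := D)) s)) =
        measure (q (int (Suc t))) D * (\<Prod>s\<in>?J. measure (q s) (B s))"
      by (subst prod.insert) (auto intro!: arg_cong2[where f="(*)"] prod.cong)
    also have "indicat_real A k * \<dots> = prob a * prob b"
    proof -
      have "prob a = indicat_real A k * (\<Prod>s\<in>?J. measure (q s) (B s))"
        unfolding a(1) cyl_def using a by (intro measure_std_prob_cylinder) auto
      moreover have "prob b = indicat_real E k * (\<Prod>s\<in>{int (Suc t)}. measure (q s) D)"
        unfolding b(1) cyl_def using b by (intro measure_std_prob_cylinder) auto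
      ultimately show ?thesis
        using k by simp
    qed
    finally show "prob (a \<inter> b) = prob a * prob b" .
  qed (use ev in auto)
  moreover have "Int_stable ?PS"
  proof (rule Int_stableI, clarify)
    fix A A' and B B' :: "int \<Rightarrow> 'g set"
    assume "A \<subseteq> E" "\<forall>s. B s \<subseteq> G" "A' \<subseteq> E" "\<forall>s. B' s \<subseteq> G"
    moreover have "cyl ?J A B \<inter> cyl ?J A' B' = cyl ?J (A \<inter> A') (\<lambda>s. B s \<inter> B' s)"
      by (auto simp: cyl_def)
    ultimately show "\<exists>A'' B''. cyl ?J A B \<inter> cyl ?J A' B' = cyl ?J A'' B'' \<and> A'' \<subseteq> E \<and> (\<forall>s. B'' s \<subseteq> G)"
      by blast
  qed
  moreover have "Int_stable ?N"
  proof (rule Int_stableI, clarify)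
    fix D D' assume "D \<subseteq> G" "D' \<subseteq> G"
    moreover have "cyl {int (Suc t)} E (\<lambda>_. D) \<inter> cyl {int (Suc t)} E (\<lambda>_. D')
        = cyl {int (Suc t)} E (\<lambda>_. D \<inter> D')"
      by (auto simp: cyl_def)
    ultimately show "\<exists>D''. cyl {int (Suc t)} E (\<lambda>_. D) \<inter> cyl {int (Suc t)} E (\<lambda>_. D')
        = cyl {int (Suc t)} E (\<lambda>_. D'') \<and> D'' \<subseteq> G"
      by blast
  qed
  ultimately have "indep_set (sigma_sets (space (std_prob E Q k)) ?PS)
      (sigma_sets (space (std_prob E Q k)) ?N)"
    by (rule indep_set_sigma_sets)
  moreover have "C \<in> sigma_sets (space (std_prob E Q k)) ?PS"
  proof -
    \<comment> \<open>Each generator of the filtration is itself a cylinder whose remaining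
      coordinates are left free by putting \<open>E\<close> or \<open>G\<close> there.\<close>
    have "fst -` A \<inter> space (std_space E G) = cyl ?J A (\<lambda>_. G)" for A
      by (auto simp: cyl_def space_std)
    then have fst_PS: "fst -` A \<inter> space (std_space E G) \<in> ?PS" if "A \<subseteq> E" for A
      using that by blast
    have snd_PS: "(\<lambda>\<omega>. snd \<omega> s) -` B \<inter> space (std_space E G) \<in> ?PS"
      if "1 \<le> s" "s \<le> int t" "B \<subseteq> G" for s B
    proof (intro CollectI exI conjI)
      show "(\<lambda>\<omega>. snd \<omega> s) -` B \<inter> space (std_space E G) =
          cyl ?J E (\<lambda>s'. if s' = s then B else G)"
        using that by (auto simp: cyl_def space_std split: if_splits)
    qed (use that in auto)
    have "{fst -` A \<inter> space (std_space E G) | A. A \<subseteq> E} \<union>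
       {(\<lambda>\<omega>. snd \<omega> s) -` B \<inter> space (std_space E G) | s B. 1 \<le> s \<and> s \<le> int t \<and> B \<subseteq> G} \<subseteq> ?PS"
      (is "?FST \<union> ?SND \<subseteq> _")
    proof (intro Un_least subsetI)
      fix S assume "S \<in> ?FST"
      then obtain A where "S = fst -` A \<inter> space (std_space E G)" "A \<subseteq> E"
        by (elim CollectE exE conjE)
      then show "S \<in> ?PS"
        by (simp only: fst_PS)
    next
      fix S assume "S \<in> ?SND"
      then obtain s B where "S = (\<lambda>\<omega>. snd \<omega> s) -` B \<inter> space (std_space E G)"
        "1 \<le> s" "s \<le> int t" "B \<subseteq> G"
        by (elim CollectE exE conjE)
      then show "S \<in> ?PS"
        by (simp only: snd_PS)
    qed
    with C show ?thesis
      unfolding sets_filtration space_std_prob by (meson sigma_sets_mono' subsetD)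
  qed
  moreover have "Y -` D \<inter> space (std_prob E Q k) \<in> sigma_sets (space (std_prob E Q k)) ?N"
  proof (intro sigma_sets.Basic CollectI exI conjI)
    show "Y -` D \<inter> space (std_prob E Q k) = cyl {int (Suc t)} E (\<lambda>_. D)"
      by (auto simp: cyl_def space_std Y_def)
  qed fact
  ultimately show ?thesis
    by (rule indep_setD)
qed

text \<open>\<open>H\<close> may be any sigma-algebra inside the past that makes the present state
  measurable; independence of the next symbol is inherited from the past. Both sigma-algebras in the
  Markov property are instances.\<close>

lemma cond_prob_std_process:
  assumes j: "j \<in> E"
    and P: "\<And>i. i \<in> E \<Longrightarrow> measure (q (int (Suc t))) {g \<in> G. fst (\<phi> (i, g)) = j} = P i j"
    and H: "subalgebra (std_filtration E G t) H"
      "(\<lambda>\<omega>. fst (std_process \<phi> t \<omega>)) \<in> H \<rightarrow>\<^sub>M count_space E"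
  shows "AE \<omega> in std_prob E Q k. cond_prob_on (std_prob E Q k) H
      {\<omega> \<in> space (std_space E G). fst (std_process \<phi> (Suc t) \<omega>) = j} \<omega>
    = P (fst (std_process \<phi> t \<omega>)) j"
proof -
  interpret prob_space "std_prob E Q k" by (fact prob_space_std_prob)
  let ?f = "\<lambda>i g. fst (\<phi> (i, g))"
  let ?Y = "\<lambda>\<omega>. snd \<omega> (int (Suc t))"
  have "AE \<omega> in std_prob E Q k. real_cond_exp (std_prob E Q k) H (indicat_real
      {\<omega> \<in> space (std_prob E Q k). ?f (fst (std_process \<phi> t \<omega>)) (?Y \<omega>) = j}) \<omega>
    = P (fst (std_process \<phi> t \<omega>)) j"
  proof (rule cond_exp_independent_noise[where f = ?f and Y = ?Y and G = G and p = "\<lambda>i. P i j"])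
    show "subalgebra (std_prob E Q k) H"
      using H(1) subalgebra_filtration[of t] by (auto simp: subalgebra_def)
    show "?Y \<in> std_prob E Q k \<rightarrow>\<^sub>M count_space G"
      unfolding measurable_cong_sets[OF sets_std_prob refl] by (rule snd_coordinate_measurable)
    show "prob (C \<inter> (?Y -` D \<inter> space (std_prob E Q k)))
        = prob C * prob (?Y -` D \<inter> space (std_prob E Q k))" if "C \<in> sets H" "D \<subseteq> G" for C D
      using that H(1) by (intro filtration_independent) (auto simp: subalgebra_def)
    show "prob {\<omega> \<in> space (std_prob E Q k). ?f i (?Y \<omega>) = j} = P i j" if "i \<in> E" for i
    proof -
      have "{\<omega> \<in> space (std_prob E Q k). ?f i (?Y \<omega>) = j} = {\<omega> \<in> space (std_space E G).
          fst \<omega> \<in> E \<and> (\<forall>s\<in>{int (Suc t)}. snd \<omega> s \<in> {g \<in> G. ?f i g = j})}"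
        by (auto simp: space_std)
      also have "prob \<dots> = indicat_real E k * (\<Prod>s\<in>{int (Suc t)}. measure (q s) {g \<in> G. ?f i g = j})"
        by (rule measure_std_prob_cylinder) auto
      finally show ?thesis
        using k P[OF that] by simp
    qed
  qed (fact finite_E H(2))+
  then show ?thesis
    by (simp add: cond_prob_on_def fst_std_process_Suc)
qed

end

section \<open>Assembling a standard dilation from the one-step laws\<close>

text \<open>The matrices enter only through the mass that \<open>q (int (Suc t))\<close> gives to
  the symbols moving \<open>i\<close> to \<open>j\<close>; everything else follows from the
  structure of \<open>step\<close> and the independence of the noise.\<close>

theorem standard_dilation:
  assumes P: "\<And>t i j. i \<in> E \<Longrightarrow> j \<in> E \<Longrightarrow>
    measure (q (int (Suc t))) {g \<in> G. fst (\<phi> (i, g)) = j} = P (Suc t) i j"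
  shows "standard_dilation E P G \<phi> Q"
proof -
  have law: "std_noise_law G Q"
    unfolding std_noise_law_def using prob_Q0 sets_Q0 prob_q sets_q Q_def by blast
  have distr_0: "distr (std_prob E Q k) (count_space E) fst = return (count_space E) k" for k
  proof -
    interpret Q: prob_space Q by (fact prob_space_Q)
    have "distr (std_prob E Q k) (return (count_space E) k) fst = return (count_space E) k"
      unfolding std_prob_def by (rule Q.distr_pair_fst)
    moreover have "distr (std_prob E Q k) (count_space E) fst =
        distr (std_prob E Q k) (return (count_space E) k) fst"
      by (rule distr_cong) auto
    ultimately show ?thesis
      by simp
  qed
  have chain: "markov_chain E P (std_space E G) (std_filtration E G)
      (\<lambda>t \<omega>. fst (std_process \<phi> t \<omega>)) (std_prob E Q)"
    unfolding markov_chain_def Let_def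
  proof (intro conjI allI ballI)
    fix k j t assume k: "k \<in> E" and j: "j \<in> E"
    let ?A = "{\<omega> \<in> space (std_space E G). fst (std_process \<phi> (Suc t) \<omega>) = j}"
    let ?\<sigma>X = "vimage_algebra (space (std_space E G)) (\<lambda>\<omega>. fst (std_process \<phi> t \<omega>)) (count_space E)"
    have adapted: "(\<lambda>\<omega>. fst (std_process \<phi> t \<omega>)) \<in> std_filtration E G t \<rightarrow>\<^sub>M count_space E"
      by (rule std_process_adapted) simp
    have "sets ?\<sigma>X \<subseteq> sets (std_filtration E G t)"
      by (rule sets_image_in_sets) (use adapted in auto)
    then have sub: "subalgebra (std_filtration E G t) ?\<sigma>X"
      by (simp add: subalgebra_def)
    have meas: "(\<lambda>\<omega>. fst (std_process \<phi> t \<omega>)) \<in> ?\<sigma>X \<rightarrow>\<^sub>M count_space E"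
      using measurable_space[OF adapted] by (intro measurable_vimage_algebra1) auto
    have trans: "measure (q (int (Suc t))) {g \<in> G. fst (\<phi> (i, g)) = j} = P (Suc t) i j"
      if "i \<in> E" for i
      using P that j by blast
    \<comment> \<open>Conditioning on the present and on the whole past produces the same matrix
      entry almost everywhere, which is the Markov property.\<close>
    have \<sigma>X: "AE \<omega> in std_prob E Q k. cond_prob_on (std_prob E Q k) ?\<sigma>X ?A \<omega>
        = P (Suc t) (fst (std_process \<phi> t \<omega>)) j"
      by (rule cond_prob_std_process[where P = "P (Suc t)", OF k j trans sub meas])
    moreover have "AE \<omega> in std_prob E Q k. cond_prob_on (std_prob E Q k) (std_filtration E G t) ?A \<omega>
        = P (Suc t) (fst (std_process \<phi> t \<omega>)) j"
      by (rule cond_prob_std_process[where P = "P (Suc t)", OF k j trans _ adapted]) (auto simp: subalgebra_def)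
    ultimately show "AE \<omega> in std_prob E Q k. cond_prob_on (std_prob E Q k) (std_filtration E G t) ?A \<omega>
        = cond_prob_on (std_prob E Q k) ?\<sigma>X ?A \<omega>"
      by eventually_elim simp
    show "AE \<omega> in std_prob E Q k. cond_prob_on (std_prob E Q k) ?\<sigma>X ?A \<omega>
        = P (Suc t) (fst (std_process \<phi> t \<omega>)) j"
      by (fact \<sigma>X)
  qed (simp_all add: filtration_filtration subalgebra_filtration std_process_adapted
      prob_space_std_prob sets_std_prob distr_0 std_process_0)
  have "dilation E P (noise_space G) (std_space E G) (std_filtration E G) (std_process \<phi>) (std_prob E Q)"
    unfolding dilation_def std_space_def[symmetric]
  proof (intro conjI exI[of _ Q] exI[of _ step] ballI allI)
    \<comment> \<open>The sample space is the value space of the process and \<open>Z 0\<close> is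
      the identity, so its law is \<open>std_prob\<close> itself.\<close>
    show "distr (std_prob E Q k) (std_space E G) (std_process \<phi> 0) = return (count_space E) k \<Otimes>\<^sub>M Q"
      if "k \<in> E" for k
      using that by (simp add: std_process_0 std_prob_def[symmetric] distr_id2 sets_std_prob)
    show "std_process \<phi> t \<omega> = (step ^^ t) (std_process \<phi> 0 \<omega>)" for t \<omega>
      by (simp add: std_process_def step_def)
  qed (simp_all add: std_process_measurable chain prob_space_Q invertible_step)
  with law show ?thesis
    using finite_G bij by (simp add: standard_dilation_def)
qed

end

section \<open>A bijection that evaluates maps\<close>

text \<open>Precomposition leaves \<open>i\<close> unchanged, so repeating it uses the same
  transposition and cancels. The value \<open>undefined\<close> outside \<open>E\<close> keeps the
  permuted map extensional, hence in \<open>E \<rightarrow>\<^sub>E E\<close>.\<close>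

lemma bij_betw_evaluate_exchange:
  assumes "a \<in> E"
  defines "\<psi> \<equiv> \<lambda>(i, f). let h = (\<lambda>k. if k \<in> E then f (Transposition.transpose a i k) else undefined)
    in (h a, h(a := i))"
  shows "bij_betw \<psi> (E \<times> (E \<rightarrow>\<^sub>E E)) (E \<times> (E \<rightarrow>\<^sub>E E))"
    and "\<And>i f. i \<in> E \<Longrightarrow> fst (\<psi> (i, f)) = f i"
proof -
  let ?S = "E \<times> (E \<rightarrow>\<^sub>E E)"
  let ?permute = "\<lambda>(i, f). (i, \<lambda>k. if k \<in> E then f (Transposition.transpose a i k) else undefined)"
  let ?swap = "\<lambda>(i, h). (h a, h(a := i))"
  have t: "Transposition.transpose a i k \<in> E" if "i \<in> E" "k \<in> E" for i k
    using that \<open>a \<in> E\<close> by (auto simp: Transposition.transpose_def)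
  have "?permute x \<in> ?S" if "x \<in> ?S" for x
    using that t by (auto simp: PiE_iff extensional_def)
  moreover have "?permute (?permute x) = x" if "x \<in> ?S" for x
  proof (cases x)
    case (Pair i f)
    then have "i \<in> E" "f \<in> E \<rightarrow>\<^sub>E E"
      using that by auto
    \<comment> \<open>This is the twice permuted map as unfolding presents it. The inner test
      succeeds because the transposition preserves \<open>E\<close>; off \<open>E\<close>,
      extensionality of \<open>f\<close> gives \<open>undefined\<close> on both sides.\<close>
    then have "(if k \<in> E then if Transposition.transpose a i k \<in> E
        then f (Transposition.transpose a i (Transposition.transpose a i k)) else undefined
        else undefined) = f k" for k
      using t PiE_arb[of f] by simp
    then show ?thesis
      by (simp add: Pair)
  qed
  ultimately have "bij_betw ?permute ?S ?S"
    by (intro bij_betw_byWitness[where f' = ?permute]) blast+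
  moreover have "bij_betw ?swap ?S ?S"
    by (rule bij_betw_byWitness[where f' = ?swap])
      (use \<open>a \<in> E\<close> in \<open>auto simp: PiE_iff extensional_def\<close>)
  ultimately have "bij_betw (?swap \<circ> ?permute) ?S ?S"
    by (rule bij_betw_trans)
  moreover have "?swap \<circ> ?permute = \<psi>"
    by (auto simp: \<psi>_def Let_def fun_eq_iff)
  ultimately show "bij_betw \<psi> ?S ?S"
    by simp
  show "fst (\<psi> (i, f)) = f i" if "i \<in> E" for i f
    using that \<open>a \<in> E\<close> by (simp add: \<psi>_def Let_def)
qed

section \<open>The product law on maps attached to a stochastic matrix\<close>

lemma measure_point_measure_eq:
  assumes "finite G" "\<And>g. g \<in> G \<Longrightarrow> 0 \<le> w g" "B \<subseteq> G"
  shows "measure (point_measure G (\<lambda>g. ennreal (w g))) B = (\<Sum>g\<in>B. w g)"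
proof -
  have "emeasure (point_measure G (\<lambda>g. ennreal (w g))) B = (\<Sum>g\<in>B. ennreal (w g))"
    using assms by (intro emeasure_point_measure_finite)
  also have "\<dots> = ennreal (\<Sum>g\<in>B. w g)"
    using assms by (intro sum_ennreal) auto
  finally show ?thesis
    using assms by (simp add: measure_def subset_iff sum_nonneg)
qed

text \<open>Interchanging the sum over maps with the product over \<open>E\<close> turns the mass of
  a box of maps into a product of partial row sums of \<open>A\<close>.\<close>

lemma stochastic_matrix_weights:
  assumes A: "stochastic_matrix E A" and "finite E"
  defines "w \<equiv> \<lambda>f. \<Prod>k\<in>E. A k (f k)"
  shows "\<And>f. f \<in> E \<rightarrow>\<^sub>E E \<Longrightarrow> 0 \<le> w f"
    and "(\<Sum>f\<in>E \<rightarrow>\<^sub>E E. w f) = 1"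
    and "\<And>i j. i \<in> E \<Longrightarrow> j \<in> E \<Longrightarrow> (\<Sum>f\<in>{f \<in> E \<rightarrow>\<^sub>E E. f i = j}. w f) = A i j"
proof -
  show "0 \<le> w f" if "f \<in> E \<rightarrow>\<^sub>E E" for f
    unfolding w_def using A that by (intro prod_nonneg) (auto simp: stochastic_matrix_def)
  show "(\<Sum>f\<in>E \<rightarrow>\<^sub>E E. w f) = 1"
    unfolding w_def using A \<open>finite E\<close>
    by (simp add: prod_sum_PiE[symmetric] stochastic_matrix_def)
  show "(\<Sum>f\<in>{f \<in> E \<rightarrow>\<^sub>E E. f i = j}. w f) = A i j" if ij: "i \<in> E" "j \<in> E" for i j
  proof -
    \<comment> \<open>As a box, the event restricts row \<open>i\<close> to the single entry
      \<open>A i j\<close>, while every other row sums to 1.\<close>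
    have "{f \<in> E \<rightarrow>\<^sub>E E. f i = j} = (\<Pi>\<^sub>E k\<in>E. if k = i then {j} else E)"
      using ij by (auto simp: PiE_iff extensional_def split: if_splits)
    then have "(\<Sum>f\<in>{f \<in> E \<rightarrow>\<^sub>E E. f i = j}. w f) =
        (\<Prod>k\<in>E. \<Sum>l\<in>(if k = i then {j} else E). A k l)"
      unfolding w_def using \<open>finite E\<close> by (simp add: prod_sum_PiE)
    also have "\<dots> = (\<Prod>k\<in>E. if k = i then A i j else 1)"
      using A by (intro prod.cong) (auto simp: stochastic_matrix_def)
    also have "\<dots> = A i j"
      using \<open>finite E\<close> ij by simp
    finally show ?thesis .
  qed
qed

section \<open>Coding maps by numbers and choosing the noise laws\<close>

theorem theorem1:
  fixes N :: nat and E :: "nat set"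
  assumes "1 \<le> N" and "E = {1..N}"
  shows "\<exists>(G :: nat set) (\<phi> :: nat \<times> nat \<Rightarrow> nat \<times> nat)
           (Q :: (nat \<Rightarrow> nat \<Rightarrow> nat \<Rightarrow> real) \<Rightarrow> (int \<Rightarrow> nat) measure).
           standard_universal_dilation E G \<phi> Q"
proof -
  \<comment> \<open>The state 1 will be the distinguished point \<open>a\<close>; it belongs to
    \<open>E\<close> since \<open>1 \<le> N\<close>.\<close>
  have "finite E" and "1 \<in> E"
    using assms by auto
  let ?F = "E \<rightarrow>\<^sub>E E"
  have "finite ?F"
    using \<open>finite E\<close> by (intro finite_PiE) auto
  \<comment> \<open>The noise symbols are to be natural numbers, so \<open>G\<close> consists of
    codes for the maps, decoded by \<open>e\<close>; \<phi> will be \<psi> conjugated by this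
    coding.\<close>
  define G where "G = {..<card ?F}"
  obtain e where e: "bij_betw e G ?F"
    using ex_bij_betw_nat_finite[OF \<open>finite ?F\<close>] by (auto simp: G_def atLeast0LessThan)
  obtain \<psi> where \<psi>: "bij_betw \<psi> (E \<times> ?F) (E \<times> ?F)"
    and fst_\<psi>: "\<And>i f. i \<in> E \<Longrightarrow> fst (\<psi> (i, f)) = f i"
    using bij_betw_evaluate_exchange[OF \<open>1 \<in> E\<close>] by blast
  have pair_e: "bij_betw (map_prod id e) (E \<times> G) (E \<times> ?F)"
    using e by (intro bij_betw_map_prod) auto
  define \<phi> where "\<phi> = map_prod id (inv_into G e) \<circ> \<psi> \<circ> map_prod id e"
  have \<phi>: "bij_betw \<phi> (E \<times> G) (E \<times> G)"
    unfolding \<phi>_def using e bij_betw_inv_into[OF e]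
    by (intro bij_betw_trans[OF pair_e] bij_betw_trans[OF \<psi>] bij_betw_map_prod) auto
  have fst_\<phi>: "fst (\<phi> (i, g)) = e g i" if "i \<in> E" for i g
    using fst_\<psi>[OF that] by (simp add: \<phi>_def)
  have "finite G"
    by (simp add: G_def)
  define w :: "(nat \<Rightarrow> nat \<Rightarrow> real) \<Rightarrow> nat \<Rightarrow> real" where "w A g = (\<Prod>k\<in>E. A k (e g k))" for A g
  \<comment> \<open>Coordinate \<open>n \<ge> 1\<close> carries the law built from
    \<open>P n\<close>, matching the symbol used in the step from time \<open>n - 1\<close> to
    \<open>n\<close>.\<close>
  define q :: "(nat \<Rightarrow> nat \<Rightarrow> nat \<Rightarrow> real) \<Rightarrow> int \<Rightarrow> nat measure"
    where "q P n = point_measure G (\<lambda>g. ennreal (w (P (nat n)) g))" for P n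
  have e_F: "e g \<in> ?F" if "g \<in> G" for g
    using bij_betwE[OF e] that by auto
  \<comment> \<open>Sums over codes become sums over maps. A trivial \<open>R\<close> gives the
    total mass; the condition \<open>f i = j\<close> gives the transition probability.\<close>
  have sum_e: "(\<Sum>g\<in>{g \<in> G. R (e g)}. w A g) = (\<Sum>f\<in>{f \<in> ?F. R f}. \<Prod>k\<in>E. A k (f k))" for R A
  proof (rule sum.reindex_bij_betw[of e, where g = "\<lambda>f. \<Prod>k\<in>E. A k (f k)", folded w_def])
    show "bij_betw e {g \<in> G. R (e g)} {f \<in> ?F. R f}"
      using e by (auto simp: bij_betw_def inj_on_def)
  qed
  \<comment> \<open>The law of the coordinates \<open>n \<le> 0\<close> can be chosen freely;
    independent copies of \<open>q P 0\<close> are taken. As \<open>P 0\<close> is the identity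
    matrix, they put all mass on the code of the identity map.\<close>
  have data: "standard_data E G \<phi> (\<Pi>\<^sub>M n\<in>{..0}. q P 0) (q P)" if P: "P \<in> stochastic_sequences E" for P
  proof -
    have w: "0 \<le> w (P n) g" if "g \<in> G" for n g
      using stochastic_matrix_weights(1)[OF _ \<open>finite E\<close>, of "P n"] e_F[OF that] P
      by (simp add: w_def stochastic_sequences_def)
    have "(\<Sum>g\<in>G. w (P n) g) = 1" for n
      using sum_e[where R = "\<lambda>_. True"] stochastic_matrix_weights(2)[OF _ \<open>finite E\<close>, of "P n"] P
      by (simp add: stochastic_sequences_def)
    then have prob_q: "prob_space (q P n)" for n
      unfolding q_def using \<open>finite G\<close> w by (intro prob_space_point_measure) auto
    show ?thesis
    proof (rule standard_data.intro)
      show "prob_space (\<Pi>\<^sub>M n\<in>{..0}. q P 0)"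
        using prob_q by (intro prob_space_PiM)
      have sets_q: "sets (q P n) = sets (count_space G)" for n
        by (simp add: q_def sets_point_measure)
      then show "sets (\<Pi>\<^sub>M n\<in>{..0}. q P 0) = sets (\<Pi>\<^sub>M n\<in>{..0}. count_space G)"
        by (intro sets_PiM_cong refl)
      show "sets (q P n) = sets (count_space G)" for n
        by (rule sets_q)
    qed (fact \<open>finite E\<close> \<open>finite G\<close> \<phi> | rule prob_q)+
  qed
  define Q where "Q P = standard_data.Q G (\<Pi>\<^sub>M n\<in>{..0}. q P 0) (q P)" for P
  have "standard_dilation E P G \<phi> (Q P)" if P: "P \<in> stochastic_sequences E" for P
    unfolding Q_def
  proof (rule standard_data.standard_dilation[OF data[OF P]])
    fix t i j assume ij: "i \<in> E" "j \<in> E"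
    have A: "stochastic_matrix E (P (Suc t))"
      using P by (simp add: stochastic_sequences_def)
    have "measure (q P (int (Suc t))) {g \<in> G. fst (\<phi> (i, g)) = j} =
        (\<Sum>g\<in>{g \<in> G. e g i = j}. w (P (Suc t)) g)"
      unfolding q_def nat_int fst_\<phi>[OF ij(1)]
      using stochastic_matrix_weights(1)[OF A \<open>finite E\<close>] e_F \<open>finite G\<close>
      by (intro measure_point_measure_eq) (auto simp: w_def)
    also have "\<dots> = P (Suc t) i j"
      using sum_e[where R = "\<lambda>f. f i = j"] stochastic_matrix_weights(3)[OF A \<open>finite E\<close> ij]
      by (rule trans)
    finally show "measure (q P (int (Suc t))) {g \<in> G. fst (\<phi> (i, g)) = j} = P (Suc t) i j" .
  qed
  \<comment> \<open>\<open>G\<close> and \<phi> were fixed before \<open>P\<close>, and each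
    standard dilation includes the dilation property, so both conjuncts follow from the same
    fact.\<close>
  then have "standard_universal_dilation E G \<phi> Q"
    unfolding standard_universal_dilation_def universal_dilation_def standard_dilation_def by blast
  then show ?thesis
    by blast
qed

end
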